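(* Let $d\ge1$ and let $(\mathcal{F}_n)_{n\ge0}$ be a filtration. Let $\mathbf{B}_n=(B_{n,1},\dots,B_{n,d})$, $n\ge1$, be random vectors with nonnegative entries, predictable with respect to $(\mathcal{F}_n)_{n\ge0}$. Let $\mathbf{R}_n^\circ=(R_{n,1}^\circ,\dots,R_{n,d}^\circ)$ (returns per unit bet, with nonnegative entries) and $\mathbf{X}_n^\circ=(X_{n,1}^\circ,\dots,X_{n,d}^\circ)$ (profits per unit bet, $X_{n,i}^\circ=R_{n,i}^\circ-1$) be such that each of the sequences $(\mathbf{R}_n^\circ)_{n\ge1}$ and $(\mathbf{X}_n^\circ)_{n\ge1}$ is i.i.d. in $n$ and adapted to $(\mathcal{F}_n)_{n\ge0}$, with $\mathbf{R}_n^\circ$ independent of $\mathcal{F}_{n-1}$ and $\mathbf{X}_n^\circ$ independent of $\mathcal{F}_{n-1}$ for each $n\ge1$. Put $B_n=\mathbf{B}_n\cdot\mathbf{1}$, $R_n=\mathbf{B}_n\cdot\mathbf{R}_n^\circ$, $X_n=\mathbf{B}_n\cdot\mathbf{X}_n^\circ$, and $$\mathfrak{R}_n:=\frac{\sum_{k=1}^n R_k}{\sum_{k=1}^n B_k},\qquad \mathfrak{X}_n:=\frac{\sum_{k=1}^n X_k}{\sum_{k=1}^n B_k}.$$ Suppose that $$\sup_{n\ge1}\mathbb{E}[|\mathbf{B}_n|^2]<\infty\qquad\text{and}\qquad\liminf_{n\to\infty}\frac1n\sum_{k=1}^n\mathbf{B}_k\cdot\mathbf{1}>0\quad\text{a.s.}$$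 If $\mathbb{E}[|\mathbf{R}_1^\circ|^2]<\infty$, or equivalently $\mathbb{E}[|\mathbf{X}_1^\circ|^2]<\infty$, then, almost surely, $$\min_{1\le i\le d}\mathrm{RTP}(1,R_{1,i}^\circ)\le\liminf_{n\to\infty}\frac{\sum_{k=1}^n\mathbf{B}_k\cdot\mathbb{E}[\mathbf{R}_1^\circ]}{\sum_{k=1}^n\mathbf{B}_k\cdot\mathbf{1}}=\liminf_{n\to\infty}\mathfrak{R}_n\le\limsup_{n\to\infty}\mathfrak{R}_n=\limsup_{n\to\infty}\frac{\sum_{k=1}^n\mathbf{B}_k\cdot\mathbb{E}[\mathbf{R}_1^\circ]}{\sum_{k=1}^n\mathbf{B}_k\cdot\mathbf{1}}\le\max_{1\le i\le d}\mathrm{RTP}(1,R_{1,i}^\circ)$$ and $$-\max_{1\le i\le d}\mathrm{HA}(1,X_{1,i}^\circ)\le\liminf_{n\to\infty}\frac{\sum_{k=1}^n\mathbf{B}_k\cdot\mathbb{E}[\mathbf{X}_1^\circ]}{\sum_{k=1}^n\mathbf{B}_k\cdot\mathbf{1}}=\liminf_{n\to\infty}\mathfrak{X}_n\le\limsup_{n\to\infty}\mathfrak{X}_n=\limsup_{n\to\infty}\frac{\sum_{k=1}^n\mathbf{B}_k\cdot\mathbb{E}[\mathbf{X}_1^\circ]}{\sum_{k=1}^n\mathbf{B}_k\cdot\mathbf{1}}\le-\min_{1\le i\le d}\mathrm{HA}(1,X_{1,i}^\circ).$$ The limits exist under either of two additional conditions: (i) If $\mathrm{RTP}(1,R_{1,1}^\circ)=\cdots=\mathrm{RTP}(1,R_{1,d}^\circ)$,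 or equivalently $\mathrm{HA}(1,X_{1,1}^\circ)=\cdots=\mathrm{HA}(1,X_{1,d}^\circ)$, then $\lim_{n\to\infty}\mathfrak{R}_n=\mathrm{RTP}(1,R_{1,1}^\circ)$ a.s. and $\lim_{n\to\infty}\mathfrak{X}_n=-\mathrm{HA}(1,X_{1,1}^\circ)$ a.s. (ii) If $\lim_{n\to\infty}\sum_{k=1}^n\mathbf{B}_k\big/\sum_{k=1}^n\mathbf{B}_k\cdot\mathbf{1}=\mathbf{w}$ a.s., where $\mathbf{w}=(w_1,\dots,w_d)$, then $$\lim_{n\to\infty}\mathfrak{R}_n=\sum_{i=1}^d w_i\,\mathrm{RTP}(1,R_{1,i}^\circ)\quad\text{a.s.}\qquad\text{and}\qquad\lim_{n\to\infty}\mathfrak{X}_n=-\sum_{i=1}^d w_i\,\mathrm{HA}(1,X_{1,i}^\circ)\quad\text{a.s.}$$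
   Context: All random variables live on a common probability space. $\mathcal{F}_n$ is interpreted as the $\sigma$-algebra of all events known following the $n$th coup; $d$ is the number of betting opportunities per coup. Predictable means $\mathbf{B}_n$ is $\mathcal{F}_{n-1}$-measurable for every $n\ge1$. $\mathbf{1}=(1,\dots,1)\in\mathbb{R}^d$, $\cdot$ is the dot product, $|\cdot|$ is the Euclidean norm, and expectations of vectors are entrywise. For a fixed $n$, the components of $\mathbf{R}_n^\circ$ need be neither independent nor identically distributed. For a bet $B\ge0$, return $R\ge0$, and profit $X=R-B$, with $0<\mathbb{E}[B]<\infty$, $\mathbb{E}[R]<\infty$, $\mathbb{E}[|X|]<\infty$, $$\mathrm{RTP}(B,R):=\frac{\mathbb{E}[R]}{\mathbb{E}[B]},\qquad \mathrm{HA}(B,X):=-\frac{\mathbb{E}[X]}{\mathbb{E}[B]}.$$ Ratios are considered for $n$ large enough that the denominator is positive (which holds eventually, almost surely). *)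

theory Defs
  imports "HOL-Probability.Probability"
begin

text \<open>Meaningful for a bet \<open>B \<ge> 0\<close> with \<open>0 < \<E>[B] < \<infinity>\<close> and an integrable return
  \<open>R \<ge> 0\<close> (resp. an integrable profit \<open>X = R - B\<close>); outside this range the value is
  an artefact of totality.\<close>

definition RTP :: "'a measure \<Rightarrow> ('a \<Rightarrow> real) \<Rightarrow> ('a \<Rightarrow> real) \<Rightarrow> real" where
  "RTP M B R = (\<integral>\<omega>. R \<omega> \<partial>M) / (\<integral>\<omega>. B \<omega> \<partial>M)"

definition HA :: "'a measure \<Rightarrow> ('a \<Rightarrow> real) \<Rightarrow> ('a \<Rightarrow> real) \<Rightarrow> real" where
  "HA M B X = - ((\<integral>\<omega>. X \<omega> \<partial>M) / (\<integral>\<omega>. B \<omega> \<partial>M))"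

definition vec_expectation :: "'a measure \<Rightarrow> ('a \<Rightarrow> real ^ 'd) \<Rightarrow> real ^ 'd" where
  "vec_expectation M Y = (\<chi> i. \<integral>\<omega>. Y \<omega> $ i \<partial>M)"

text \<open>Sequences are indexed from 1; the value at index 0 plays no role.\<close>

definition iid_seq :: "'a measure \<Rightarrow> (nat \<Rightarrow> 'a \<Rightarrow> real ^ 'd) \<Rightarrow> bool" where
  "iid_seq M Y \<longleftrightarrow>
     prob_space.indep_vars M (\<lambda>_. borel) Y {1..} \<and>
     (\<forall>n\<ge>1. distr M borel (Y n) = distr M borel (Y 1))"

definition indep_of_subalgebra :: "'a measure \<Rightarrow> 'a measure \<Rightarrow> ('a \<Rightarrow> real ^ 'd) \<Rightarrow> bool" where
  "indep_of_subalgebra M G Y \<longleftrightarrow>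
     prob_space.indep_set M (sets (vimage_algebra (space M) Y borel)) (sets G)"

text \<open>For \<open>Y\<close> the returns (resp. profits) per unit bet, this is the cumulative return
  (resp. profit) after \<open>n\<close> coups divided by the cumulative amount bet. Where the
  denominator vanishes the value is 0; this does not affect limits inferior and superior once
  the denominator is eventually positive.\<close>

definition cum_ratio ::
  "(nat \<Rightarrow> 'a \<Rightarrow> real ^ 'd) \<Rightarrow> (nat \<Rightarrow> 'a \<Rightarrow> real ^ 'd) \<Rightarrow> nat \<Rightarrow> 'a \<Rightarrow> real" where
  "cum_ratio B Y n \<omega> = (\<Sum>k=1..n. B k \<omega> \<bullet> Y k \<omega>) / (\<Sum>k=1..n. B k \<omega> \<bullet> 1)"

end

theory Submission
  imports Defs "HOL-Library.Discrete_Functions"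
begin

text \<open>
  Since \<open>B k\<close> and the earlier terms are known before coup \<open>k\<close>, while \<open>Y k\<close> is independent of that past,
  the centred terms \<open>B k $ i * (Y k $ i - \<mu> $ i)\<close> are pairwise orthogonal with uniformly bounded second
  moments. Orthogonality and the second moment bound alone give a strong law: the averages converge to 0
  along the squares by summability of second moments, and the fluctuation between consecutive squares is
  controlled in the same way, so no martingale convergence theorem is needed. As the cumulative bets
  eventually grow at least linearly, the ratios for \<open>Y\<close> and for its mean \<open>\<mu>\<close> are asymptotically equal;
  the latter are averages of the entries of \<open>\<mu>\<close> weighted by the bets.
\<close>

section \<open>A strong law for orthogonal sequences with bounded second moments\<close>

lemma integrable_mult_of_squares:
  fixes f g :: "'a \<Rightarrow> real"
  assumes [measurable]: "f \<in> borel_measurable M" "g \<in> borel_measurable M"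
    and "integrable M (\<lambda>x. (f x)\<^sup>2)" "integrable M (\<lambda>x. (g x)\<^sup>2)"
  shows "integrable M (\<lambda>x. f x * g x)"
proof (rule Bochner_Integration.integrable_bound)
  show "integrable M (\<lambda>x. (f x)\<^sup>2 + (g x)\<^sup>2)"
    using assms by simp
  show "AE x in M. norm (f x * g x) \<le> norm ((f x)\<^sup>2 + (g x)\<^sup>2)"
  proof (rule AE_I2)
    fix x
    have "2 * (\<bar>f x\<bar> * \<bar>g x\<bar>) \<le> (f x)\<^sup>2 + (g x)\<^sup>2"
      using sum_squares_bound[of "\<bar>f x\<bar>" "\<bar>g x\<bar>"] by simp
    moreover have "0 \<le> \<bar>f x\<bar> * \<bar>g x\<bar>" by simp
    ultimately show "norm (f x * g x) \<le> norm ((f x)\<^sup>2 + (g x)\<^sup>2)"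
      unfolding real_norm_def abs_mult by linarith
  qed
qed simp

text \<open>When the square is expanded, only the diagonal terms survive, so the second moment grows
  linearly in the number of terms. The index set is arbitrary so that the bound serves both initial
  segments and blocks that start at a square.\<close>

lemma orthogonal_sum_second_moment:
  fixes Z :: "nat \<Rightarrow> 'a \<Rightarrow> real"
  assumes [measurable]: "\<And>k. Z k \<in> borel_measurable M"
    and sq: "\<And>k. integrable M (\<lambda>\<omega>. (Z k \<omega>)\<^sup>2)"
    and bnd: "\<And>k. (\<integral>\<omega>. (Z k \<omega>)\<^sup>2 \<partial>M) \<le> C"
    and orth: "\<And>j k. j < k \<Longrightarrow> (\<integral>\<omega>. Z j \<omega> * Z k \<omega> \<partial>M) = 0"
    and "finite A"
  shows "integrable M (\<lambda>\<omega>. (\<Sum>k\<in>A. Z k \<omega>)\<^sup>2)"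
    and "(\<integral>\<omega>. (\<Sum>k\<in>A. Z k \<omega>)\<^sup>2 \<partial>M) \<le> C * card A"
proof -
  have int: "integrable M (\<lambda>\<omega>. Z j \<omega> * Z k \<omega>)" for j k
    by (intro integrable_mult_of_squares sq) auto
  have expand: "(\<Sum>k\<in>A. Z k \<omega>)\<^sup>2 = (\<Sum>j\<in>A. \<Sum>k\<in>A. Z j \<omega> * Z k \<omega>)" for \<omega>
    by (simp add: power2_eq_square sum_product)
  show "integrable M (\<lambda>\<omega>. (\<Sum>k\<in>A. Z k \<omega>)\<^sup>2)"
    unfolding expand by (intro Bochner_Integration.integrable_sum int)
  have cross: "(\<integral>\<omega>. Z j \<omega> * Z k \<omega> \<partial>M) = (if j = k then \<integral>\<omega>. (Z k \<omega>)\<^sup>2 \<partial>M else 0)" for j k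
    using orth[of j k] orth[of k j] by (cases j k rule: linorder_cases) (auto simp: power2_eq_square mult.commute)
  have "(\<integral>\<omega>. (\<Sum>k\<in>A. Z k \<omega>)\<^sup>2 \<partial>M) = (\<Sum>j\<in>A. \<Sum>k\<in>A. \<integral>\<omega>. Z j \<omega> * Z k \<omega> \<partial>M)"
    unfolding expand by (simp add: int)
  also have "\<dots> = (\<Sum>k\<in>A. \<integral>\<omega>. (Z k \<omega>)\<^sup>2 \<partial>M)"
    unfolding cross using \<open>finite A\<close> by simp
  also have "\<dots> \<le> C * card A"
    using sum_bounded_above[of A "\<lambda>k. \<integral>\<omega>. (Z k \<omega>)\<^sup>2 \<partial>M" C] bnd by (simp add: mult.commute)
  finally show "(\<integral>\<omega>. (\<Sum>k\<in>A. Z k \<omega>)\<^sup>2 \<partial>M) \<le> C * card A" .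
qed

text \<open>By Tonelli the series of the \<open>T n\<close> has finite expectation, hence is finite
  almost surely, and the terms of a convergent series tend to 0. This plays the part of Chebyshev
  with Borel-Cantelli.\<close>

lemma AE_tendsto_0_if_summable_integrals:
  fixes T :: "nat \<Rightarrow> 'a \<Rightarrow> real"
  assumes int: "\<And>n. integrable M (T n)"
    and nonneg: "\<And>n \<omega>. 0 \<le> T n \<omega>"
    and le: "\<And>n. (\<integral>\<omega>. T n \<omega> \<partial>M) \<le> c n"
    and "summable c"
  shows "AE \<omega> in M. (\<lambda>n. T n \<omega>) \<longlonglongrightarrow> 0"
proof -
  note [measurable] = borel_measurable_integrable[OF int]
  have c: "0 \<le> c n" for n
    using le[of n] Bochner_Integration.integral_nonneg[of M "T n"] nonneg by (meson order_trans)
  have "(\<integral>\<^sup>+\<omega>. (\<Sum>n. ennreal (T n \<omega>)) \<partial>M) = (\<Sum>n. \<integral>\<^sup>+\<omega>. ennreal (T n \<omega>) \<partial>M)"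
    by (intro nn_integral_suminf) simp
  also have "\<dots> \<le> (\<Sum>n. ennreal (c n))"
    by (intro suminf_le) (auto simp: nn_integral_eq_integral int nonneg le intro: ennreal_leI)
  also have "\<dots> < \<infinity>"
    using \<open>summable c\<close> c by (simp add: suminf_ennreal2)
  finally have "AE \<omega> in M. (\<Sum>n. ennreal (T n \<omega>)) \<noteq> \<infinity>"
    by (intro nn_integral_PInf_AE) auto
  then show ?thesis
    by eventually_elim (auto intro!: summable_LIMSEQ_zero summable_suminf_not_top nonneg)
qed

lemma filterlim_floor_sqrt: "filterlim floor_sqrt at_top at_top"
  unfolding filterlim_at_top eventually_at_top_linorder
  using le_floor_sqrt_iff by blast

text \<open>The second moment of the average of \<open>n\<close> terms is bounded only by
  \<open>C / n\<close>, which is not summable; at \<open>n^2\<close> terms the bound is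
  \<open>C / n^2\<close>. The block up to the next square has just \<open>2 * n + 1\<close> indices,
  so summing the squared increments over it replaces a maximal inequality.\<close>

lemma averages_of_orthogonal_tendsto_0:
  fixes Z :: "nat \<Rightarrow> 'a \<Rightarrow> real"
  assumes [measurable]: "\<And>k. Z k \<in> borel_measurable M"
    and sq: "\<And>k. integrable M (\<lambda>\<omega>. (Z k \<omega>)\<^sup>2)"
    and bnd: "\<And>k. (\<integral>\<omega>. (Z k \<omega>)\<^sup>2 \<partial>M) \<le> C"
    and orth: "\<And>j k. j < k \<Longrightarrow> (\<integral>\<omega>. Z j \<omega> * Z k \<omega> \<partial>M) = 0"
  shows "AE \<omega> in M. (\<lambda>n. (\<Sum>k<n. Z k \<omega>) / n) \<longlonglongrightarrow> 0"
proof -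
  define S where "S n \<omega> = (\<Sum>k<n. Z k \<omega>)" for n \<omega>
  \<comment> \<open>\<open>T n\<close> bounds the squared averages over the whole block of indices from \<open>n\<^sup>2\<close> to \<open>(n + 1)\<^sup>2 - 1\<close>,
    up to a factor 4, and its integral is \<open>O(1 / n\<^sup>2)\<close>.\<close>
  define T where "T n \<omega> = (S (n\<^sup>2) \<omega> / n\<^sup>2)\<^sup>2 + (\<Sum>m\<le>2*n. ((S (n\<^sup>2 + m) \<omega> - S (n\<^sup>2) \<omega>) / n\<^sup>2)\<^sup>2)"
    for n \<omega>
  have moment: "integrable M (\<lambda>\<omega>. (\<Sum>k\<in>A. Z k \<omega>)\<^sup>2)"
      "(\<integral>\<omega>. (\<Sum>k\<in>A. Z k \<omega>)\<^sup>2 \<partial>M) \<le> C * card A" if "finite A" for A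
    using orthogonal_sum_second_moment[of Z M C A] assms that by blast+
  have C: "0 \<le> C"
    using bnd[of 0] Bochner_Integration.integral_nonneg[of M "\<lambda>\<omega>. (Z 0 \<omega>)\<^sup>2"]
    by (meson order_trans zero_le_power2)
  have incr: "S (N + m) \<omega> - S N \<omega> = (\<Sum>k\<in>{N..<N+m}. Z k \<omega>)" for N m \<omega>
    unfolding S_def lessThan_atLeast0 using sum_diff_nat_ivl[of 0 N "N+m" "\<lambda>k. Z k \<omega>"] by simp
  have T_eq: "T n = (\<lambda>\<omega>. ((\<Sum>k<n\<^sup>2. Z k \<omega>)\<^sup>2 + (\<Sum>m\<le>2*n. (\<Sum>k\<in>{n\<^sup>2..<n\<^sup>2+m}. Z k \<omega>)\<^sup>2)) / n^4)" for n
  proof -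
    have "(x / real (n\<^sup>2))\<^sup>2 = x\<^sup>2 / n^4" for x :: real
      by (simp add: power_divide flip: power_mult)
    then show ?thesis
      unfolding T_def incr S_def[of "n\<^sup>2"] by (simp only: add_divide_distrib sum_divide_distrib[of _ "{..2*n}"])
  qed
  have T_int: "integrable M (T n)" for n
    unfolding T_eq by (intro integrable_divide Bochner_Integration.integrable_add Bochner_Integration.integrable_sum moment) auto
  \<comment> \<open>The constant is 1 + 9: the start of the block contributes
    \<open>C * n^2\<close>, and its \<open>2 * n + 1\<close> increments contribute at most
    \<open>C * (2 * n + 1)^2\<close>, where \<open>2 * n + 1 \<le> 3 * n\<close>. For
    \<open>n = 0\<close> both sides are 0, since division by zero gives 0.\<close>
  have T_le: "(\<integral>\<omega>. T n \<omega> \<partial>M) \<le> 10 * C * inverse (real n ^ 2)" for n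
  proof (cases "n = 0")
    case False
    have "(\<integral>\<omega>. T n \<omega> \<partial>M) = ((\<integral>\<omega>. (\<Sum>k<n\<^sup>2. Z k \<omega>)\<^sup>2 \<partial>M)
        + (\<Sum>m\<le>2*n. (\<integral>\<omega>. (\<Sum>k\<in>{n\<^sup>2..<n\<^sup>2+m}. Z k \<omega>)\<^sup>2 \<partial>M))) / n^4"
      unfolding T_eq by (simp add: moment)
    also have "\<dots> \<le> (C * real (n\<^sup>2) + (\<Sum>m\<le>2*n. C * real (2*n+1))) / n^4"
    proof (intro divide_right_mono add_mono sum_mono)
      show "(\<integral>\<omega>. (\<Sum>k<n\<^sup>2. Z k \<omega>)\<^sup>2 \<partial>M) \<le> C * real (n\<^sup>2)"
        using moment(2)[where A="{..<n\<^sup>2}"] by simp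
      fix m assume "m \<in> {..2*n}"
      then have "C * real m \<le> C * real (2*n+1)"
        by (intro mult_left_mono C) auto
      then show "(\<integral>\<omega>. (\<Sum>k\<in>{n\<^sup>2..<n\<^sup>2+m}. Z k \<omega>)\<^sup>2 \<partial>M) \<le> C * real (2*n+1)"
        using moment(2)[where A="{n\<^sup>2..<n\<^sup>2+m}"] by simp
    qed auto
    also have "\<dots> = C * (real n ^ 2 + (2 * real n + 1)^2) / real n ^ 4"
      by (simp add: algebra_simps power2_eq_square)
    also have "\<dots> \<le> C * (10 * real n ^ 2) / real n ^ 4"
    proof (intro divide_right_mono mult_left_mono C)
      have "(2 * real n + 1)^2 \<le> (3 * real n)^2"
        using False by (intro power_mono) auto
      then show "real n ^ 2 + (2 * real n + 1)^2 \<le> 10 * real n ^ 2"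
        by (simp add: power_mult_distrib)
    qed auto
    also have "\<dots> = 10 * C * inverse (real n ^ 2)"
      using False by (simp add: field_simps power_numeral_reduce)
    finally show ?thesis .
  qed (simp add: T_def)
  have T_nonneg: "0 \<le> T n \<omega>" for n \<omega>
    unfolding T_def by (intro add_nonneg_nonneg sum_nonneg) auto
  have "AE \<omega> in M. (\<lambda>n. T n \<omega>) \<longlonglongrightarrow> 0"
    by (rule AE_tendsto_0_if_summable_integrals[OF T_int T_nonneg T_le])
      (intro summable_mult inverse_power_summable, simp)
  then show ?thesis
  proof eventually_elim
    case (elim \<omega>)
    have "(\<lambda>n. 2 * sqrt (T (floor_sqrt n) \<omega>)) \<longlonglongrightarrow> 2 * sqrt 0"
      by (intro tendsto_intros filterlim_compose[OF elim filterlim_floor_sqrt])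
    then have lim: "(\<lambda>n. 2 * sqrt (T (floor_sqrt n) \<omega>)) \<longlonglongrightarrow> 0" by simp
    \<comment> \<open>With \<open>q\<close> the integer square root, \<open>n\<close> lies in block
      \<open>q\<close> at offset \<open>m \<le> 2 * q\<close>. Dividing by \<open>q^2\<close>, which
      is at most \<open>n\<close>, splits the average into its value at the start of the block and
      an increment; each is at most the square root of \<open>T q\<close>, whence the factor
      2.\<close>
    have "\<bar>S n \<omega> / n\<bar> \<le> 2 * sqrt (T (floor_sqrt n) \<omega>)" if "n \<ge> 1" for n
    proof -
      define q where "q = floor_sqrt n"
      define m where "m = n - q\<^sup>2"
      have n: "n = q\<^sup>2 + m" and q: "0 < q"
        using that by (auto simp: m_def q_def)
      have m: "m \<le> 2*q"
        using Suc_floor_sqrt_power2_gt[of n] n unfolding q_def[symmetric] by (simp add: power2_eq_square)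
      have T: "(S (q\<^sup>2) \<omega> / q\<^sup>2)\<^sup>2 \<le> T q \<omega>" "((S n \<omega> - S (q\<^sup>2) \<omega>) / q\<^sup>2)\<^sup>2 \<le> T q \<omega>"
      proof -
        show "(S (q\<^sup>2) \<omega> / q\<^sup>2)\<^sup>2 \<le> T q \<omega>"
          unfolding T_def by (simp add: sum_nonneg)
        have "((S (q\<^sup>2 + m) \<omega> - S (q\<^sup>2) \<omega>) / q\<^sup>2)\<^sup>2 \<le>
            (\<Sum>m\<le>2*q. ((S (q\<^sup>2 + m) \<omega> - S (q\<^sup>2) \<omega>) / q\<^sup>2)\<^sup>2)"
          using m by (intro member_le_sum) auto
        then show "((S n \<omega> - S (q\<^sup>2) \<omega>) / q\<^sup>2)\<^sup>2 \<le> T q \<omega>"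
          unfolding T_def n by (simp add: add_increasing)
      qed
      have "\<bar>S n \<omega> / n\<bar> \<le> \<bar>S n \<omega>\<bar> / q\<^sup>2"
        unfolding abs_divide abs_of_nat by (rule frac_le) (use q n in auto)
      also have "\<dots> \<le> \<bar>S (q\<^sup>2) \<omega> / q\<^sup>2\<bar> + \<bar>(S n \<omega> - S (q\<^sup>2) \<omega>) / q\<^sup>2\<bar>"
        by (simp add: abs_divide flip: add_divide_distrib) (intro divide_right_mono, auto)
      also have "\<dots> \<le> sqrt (T q \<omega>) + sqrt (T q \<omega>)"
        using T by (intro add_mono real_le_rsqrt) (simp_all only: power2_abs)
      finally show ?thesis by (simp add: q_def)
    qed
    then have "eventually (\<lambda>n. norm (S n \<omega> / n) \<le> 2 * sqrt (T (floor_sqrt n) \<omega>)) sequentially"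
      unfolding eventually_at_top_linorder by auto
    from Lim_null_comparison[OF this lim] show ?case
      by (simp add: S_def)
  qed
qed


section \<open>Second moments of random vectors, independence of the past, and predictable
  transforms\<close>

lemma borel_measurable_vec_nth [measurable (raw)]:
  fixes Y :: "'a \<Rightarrow> real ^ 'd"
  shows "Y \<in> borel_measurable N \<Longrightarrow> (\<lambda>\<omega>. Y \<omega> $ i) \<in> borel_measurable N"
  by (rule measurable_compose[OF _ borel_measurable_continuous_onI[OF continuous_on_component[OF continuous_on_id]]])

text \<open>Passes from extended nonnegative integrals, in which the moment hypotheses are stated,
  to Bochner integrals with the same constant.\<close>

lemma component_second_moment:
  fixes Y :: "'a \<Rightarrow> real ^ 'd"
  assumes [measurable]: "Y \<in> borel_measurable M"
    and le: "(\<integral>\<^sup>+\<omega>. ennreal ((norm (Y \<omega>))\<^sup>2) \<partial>M) \<le> ennreal C" and "0 \<le> C"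
  shows "integrable M (\<lambda>\<omega>. (Y \<omega> $ i)\<^sup>2)" and "(\<integral>\<omega>. (Y \<omega> $ i)\<^sup>2 \<partial>M) \<le> C"
proof -
  have "(Y \<omega> $ i)\<^sup>2 \<le> (norm (Y \<omega>))\<^sup>2" for \<omega>
    using component_le_norm_cart[of "Y \<omega>" i] by (metis abs_le_square_iff abs_norm_cancel)
  then have "(\<integral>\<^sup>+\<omega>. ennreal ((Y \<omega> $ i)\<^sup>2) \<partial>M) \<le> (\<integral>\<^sup>+\<omega>. ennreal ((norm (Y \<omega>))\<^sup>2) \<partial>M)"
    by (intro nn_integral_mono ennreal_leI)
  with le have *: "(\<integral>\<^sup>+\<omega>. ennreal ((Y \<omega> $ i)\<^sup>2) \<partial>M) \<le> ennreal C"
    by (rule order_trans[rotated])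
  show int: "integrable M (\<lambda>\<omega>. (Y \<omega> $ i)\<^sup>2)"
    using * by (intro integrableI_nonneg) (auto intro: le_less_trans)
  show "(\<integral>\<omega>. (Y \<omega> $ i)\<^sup>2 \<partial>M) \<le> C"
    using * \<open>0 \<le> C\<close> by (simp add: nn_integral_eq_integral[OF int])
qed

lemma (in prob_space) square_integrable_vec:
  fixes Y :: "'a \<Rightarrow> real ^ 'd"
  assumes Y: "Y \<in> borel_measurable M"
    and moment: "(\<integral>\<^sup>+ \<omega>. ennreal ((norm (Y \<omega>))\<^sup>2) \<partial>M) < \<infinity>"
  shows "integrable M (\<lambda>\<omega>. Y \<omega> $ i)"
proof -
  obtain D where "(\<integral>\<^sup>+ \<omega>. ennreal ((norm (Y \<omega>))\<^sup>2) \<partial>M) = ennreal D" "0 \<le> D"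
    using moment unfolding infinity_ennreal_def less_top_ennreal by blast
  then have "integrable M (\<lambda>\<omega>. (Y \<omega> $ i)\<^sup>2)"
    by (intro component_second_moment(1)[OF Y, of D]) simp_all
  then show ?thesis
    by (rule square_integrable_imp_integrable[OF borel_measurable_vec_nth[OF Y]])
qed

text \<open>The sigma-algebra generated by \<open>W\<close> lies in \<open>G\<close> and that of
  \<open>g (Y \<omega>)\<close> in that of \<open>Y\<close>; independence passes to smaller families
  of events.\<close>

lemma (in prob_space) indep_var_if_indep_of_subalgebra:
  fixes Y :: "'a \<Rightarrow> real ^ 'd"
  assumes sub: "subalgebra M G" and indep: "indep_of_subalgebra M G Y"
    and [measurable]: "Y \<in> borel_measurable M" and g[measurable]: "g \<in> borel_measurable borel"
    and W: "W \<in> borel_measurable G"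
  shows "indep_var borel W borel (\<lambda>\<omega>. g (Y \<omega>))"
  unfolding indep_var_eq
proof (intro conjI)
  show "random_variable borel W"
    using measurable_from_subalg[OF sub W] .
  show "random_variable borel (\<lambda>\<omega>. g (Y \<omega>))"
    by simp
  have "sigma_sets (space M) {W -` A \<inter> space M |A. A \<in> sets borel} \<subseteq> sets G"
  proof -
    have "space G = space M" using sub by (simp add: subalgebra_def)
    then show ?thesis
      using measurable_sets[OF W] sets.sigma_sets_subset[of "{W -` A \<inter> space M |A. A \<in> sets borel}" G]
      by auto
  qed
  moreover have "sigma_sets (space M) {(\<lambda>\<omega>. g (Y \<omega>)) -` A \<inter> space M |A. A \<in> sets borel}
      \<subseteq> sets (vimage_algebra (space M) Y borel)"
  proof -
    have "(\<lambda>\<omega>. g (Y \<omega>)) \<in> borel_measurable (vimage_algebra (space M) Y borel)"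
      by (rule measurable_compose[OF measurable_vimage_algebra1 g]) auto
    from measurable_sets[OF this]
    have "{(\<lambda>\<omega>. g (Y \<omega>)) -` A \<inter> space M |A. A \<in> sets borel} \<subseteq> sets (vimage_algebra (space M) Y borel)"
      by auto
    from sets.sigma_sets_subset[OF this] show ?thesis by simp
  qed
  \<comment> \<open>\<open>indep_of_subalgebra\<close> puts the events of \<open>Y\<close> first, so
    the two sides are exchanged here.\<close>
  moreover have "indep_set (sets G) (sets (vimage_algebra (space M) Y borel))"
    using indep unfolding indep_of_subalgebra_def indep_sets2_eq by (metis Int_commute mult.commute)
  ultimately show "indep_set (sigma_sets (space M) {W -` A \<inter> space M |A. A \<in> sets borel})
      (sigma_sets (space M) {(\<lambda>\<omega>. g (Y \<omega>)) -` A \<inter> space M |A. A \<in> sets borel})"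
    unfolding indep_sets2_eq by (meson subset_trans subsetD)
qed

text \<open>The bet \<open>U n\<close> is known before \<open>Y n\<close> is drawn. Independence
  therefore factors the second moments of the products, bounding them uniformly, and the zero mean
  of \<open>g (Y n)\<close> makes the products orthogonal. In use, \<open>g\<close> is a centred
  coordinate.\<close>

lemma (in prob_space) predictable_transform_average_tendsto_0:
  fixes Y :: "nat \<Rightarrow> 'a \<Rightarrow> real ^ 'd"
  assumes filt: "filtration (space M) F" and sub: "\<And>n. subalgebra M (F n)"
    and U: "\<And>n. n \<ge> 1 \<Longrightarrow> U n \<in> borel_measurable (F (n - 1))"
    and U_sq: "\<And>n. n \<ge> 1 \<Longrightarrow> integrable M (\<lambda>\<omega>. (U n \<omega>)\<^sup>2)"
    and U_le: "\<And>n. n \<ge> 1 \<Longrightarrow> expectation (\<lambda>\<omega>. (U n \<omega>)\<^sup>2) \<le> C"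
    and Y: "\<And>n. n \<ge> 1 \<Longrightarrow> Y n \<in> borel_measurable (F n)"
    and indep: "\<And>n. n \<ge> 1 \<Longrightarrow> indep_of_subalgebra M (F (n - 1)) (Y n)"
    and distr: "\<And>n. n \<ge> 1 \<Longrightarrow> distr M borel (Y n) = distr M borel (Y 1)"
    and g[measurable]: "g \<in> borel_measurable borel"
    and g_sq: "integrable M (\<lambda>\<omega>. (g (Y 1 \<omega>) :: real)\<^sup>2)"
    and g_mean: "expectation (\<lambda>\<omega>. g (Y 1 \<omega>)) = 0"
  shows "AE \<omega> in M. (\<lambda>n. (\<Sum>k=1..n. U k \<omega> * g (Y k \<omega>)) / n) \<longlonglongrightarrow> 0"
proof -
  have F_mono: "W \<in> borel_measurable (F n)" if "W \<in> borel_measurable (F m)" "m \<le> n"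
    for W :: "'a \<Rightarrow> real" and m n
    using measurable_mono[of borel borel "F m" "F n"] that filt
    by (auto simp: filtration.space_F filtration.sets_F_mono dest: filtration.sets_F_mono[OF filt])
  have Ym[measurable]: "Y (Suc k) \<in> borel_measurable M" for k
    using measurable_from_subalg[OF sub Y[of "Suc k"]] by simp
  have Um[measurable]: "U (Suc k) \<in> borel_measurable M" for k
    using measurable_from_subalg[OF sub U[of "Suc k"]] by simp
  have dist_Suc: "distr M borel (Y (Suc k)) = distr M borel (Y (Suc 0))" for k
    using distr[of "Suc k"] by simp
  \<comment> \<open>Identical distribution reduces every coup to the first; \<open>h\<close> will be
    the identity or the square.\<close>
  have g_int: "integrable M (\<lambda>\<omega>. h (g (Y (Suc k) \<omega>))) \<longleftrightarrow> integrable M (\<lambda>\<omega>. h (g (Y (Suc 0) \<omega>)))"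
    and g_exp: "expectation (\<lambda>\<omega>. h (g (Y (Suc k) \<omega>))) = expectation (\<lambda>\<omega>. h (g (Y (Suc 0) \<omega>)))"
    if [measurable]: "h \<in> borel_measurable borel" for h :: "real \<Rightarrow> real" and k
    using integrable_distr_eq[of "Y (Suc k)" M borel "\<lambda>y. h (g y)"]
      integrable_distr_eq[of "Y (Suc 0)" M borel "\<lambda>y. h (g y)"]
      integral_distr[of "Y (Suc k)" M borel "\<lambda>y. h (g y)"]
      integral_distr[of "Y (Suc 0)" M borel "\<lambda>y. h (g y)"]
    by (simp_all add: dist_Suc[of k])
  have V_sq: "integrable M (\<lambda>\<omega>. (g (Y (Suc k) \<omega>))\<^sup>2)" for k
    using g_int[of "\<lambda>x. x\<^sup>2" k] g_sq by simp
  have V_int: "integrable M (\<lambda>\<omega>. g (Y (Suc k) \<omega>))" for k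
    by (rule square_integrable_imp_integrable[OF _ V_sq]) simp
  have V_mean: "expectation (\<lambda>\<omega>. g (Y (Suc k) \<omega>)) = 0" for k
    using g_exp[of "\<lambda>x. x" k] g_mean by simp
  have V_second: "expectation (\<lambda>\<omega>. (g (Y (Suc k) \<omega>))\<^sup>2) = expectation (\<lambda>\<omega>. (g (Y 1 \<omega>))\<^sup>2)" for k
    using g_exp[of "\<lambda>x. x\<^sup>2" k] by simp
  \<comment> \<open>Shifted indexing: \<open>Z k\<close> belongs to coup \<open>Suc k\<close>, so
    its past is \<open>F k\<close> and it is itself measurable for \<open>F (Suc k)\<close>.\<close>
  define Z where "Z k \<omega> = U (Suc k) \<omega> * g (Y (Suc k) \<omega>)" for k \<omega>
  have Z_meas[measurable]: "Z k \<in> borel_measurable M" for k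
    unfolding Z_def by measurable
  have Z_adapted: "Z k \<in> borel_measurable (F (Suc k))" for k
    using F_mono[OF U[of "Suc k"], of "Suc k"] measurable_compose[OF Y[of "Suc k"] g]
    unfolding Z_def by (intro borel_measurable_times) auto
  have indep_V: "indep_var borel W borel (\<lambda>\<omega>. h (Y (Suc k) \<omega>))"
    if "W \<in> borel_measurable (F k)" "h \<in> borel_measurable borel" for W h k
    using indep_var_if_indep_of_subalgebra[OF sub indep[of "Suc k"] Ym that(2), of W] that by simp
  have U_sq_V_sq: "indep_var borel (\<lambda>\<omega>. (U (Suc k) \<omega>)\<^sup>2) borel (\<lambda>\<omega>. (g (Y (Suc k) \<omega>))\<^sup>2)" for k
    using U[of "Suc k"] by (intro indep_V) auto
  have "AE \<omega> in M. (\<lambda>n. (\<Sum>k<n. Z k \<omega>) / n) \<longlonglongrightarrow> 0"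
  proof (rule averages_of_orthogonal_tendsto_0)
    fix k
    have U2: "integrable M (\<lambda>\<omega>. (U (Suc k) \<omega>)\<^sup>2)" "expectation (\<lambda>\<omega>. (U (Suc k) \<omega>)\<^sup>2) \<le> C"
      using U_sq[of "Suc k"] U_le[of "Suc k"] by auto
    show "integrable M (\<lambda>\<omega>. (Z k \<omega>)\<^sup>2)"
      unfolding Z_def power_mult_distrib by (rule indep_var_integrable[OF U_sq_V_sq U2(1) V_sq])
    have "expectation (\<lambda>\<omega>. (Z k \<omega>)\<^sup>2)
        = expectation (\<lambda>\<omega>. (U (Suc k) \<omega>)\<^sup>2) * expectation (\<lambda>\<omega>. (g (Y 1 \<omega>))\<^sup>2)"
      unfolding Z_def power_mult_distrib
      by (subst indep_var_lebesgue_integral[OF U_sq_V_sq U2(1) V_sq]) (simp only: V_second)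
    also have "\<dots> \<le> C * expectation (\<lambda>\<omega>. (g (Y 1 \<omega>))\<^sup>2)"
      by (intro mult_right_mono U2) simp
    finally show "expectation (\<lambda>\<omega>. (Z k \<omega>)\<^sup>2) \<le> C * expectation (\<lambda>\<omega>. (g (Y 1 \<omega>))\<^sup>2)" .
    show "expectation (\<lambda>\<omega>. Z j \<omega> * Z k \<omega>) = 0" if "j < k" for j
    proof -
      \<comment> \<open>As \<open>Suc j \<le> k\<close>, both the earlier term and the next bet
        belong to the past \<open>F k\<close>. Grouping them leaves
        \<open>g (Y (Suc k) \<omega>)\<close> as an independent factor of mean 0.\<close>
      have ZU: "(\<lambda>\<omega>. Z j \<omega> * U (Suc k) \<omega>) \<in> borel_measurable (F k)"
        using F_mono[OF Z_adapted[of j], of k] U[of "Suc k"] that by (intro borel_measurable_times) auto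
      have "integrable M (\<lambda>\<omega>. (Z j \<omega>)\<^sup>2)"
        unfolding Z_def power_mult_distrib
        using U_sq[of "Suc j"] by (intro indep_var_integrable[OF U_sq_V_sq _ V_sq]) auto
      then have "integrable M (\<lambda>\<omega>. Z j \<omega> * U (Suc k) \<omega>)"
        using U2 by (intro integrable_mult_of_squares) auto
      then have "expectation (\<lambda>\<omega>. Z j \<omega> * U (Suc k) \<omega> * g (Y (Suc k) \<omega>)) = 0"
        using indep_var_lebesgue_integral[OF indep_V[OF ZU g] _ V_int] V_mean by simp
      then show ?thesis
        by (simp add: Z_def mult.assoc)
    qed
  qed simp
  then show ?thesis
    by (simp add: Z_def sum.atLeast1_atMost_eq)
qed

section \<open>Pathwise comparison of cumulative ratios\<close>

text \<open>Write \<open>u\<close> as \<open>(u - v) + v\<close>: the convergent summand can be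
  taken out of both limits and contributes 0.\<close>

lemma liminf_limsup_eq_if_diff_tendsto_0:
  fixes u v :: "nat \<Rightarrow> real"
  assumes "(\<lambda>n. u n - v n) \<longlonglongrightarrow> 0"
  shows "liminf (\<lambda>n. ereal (u n)) = liminf (\<lambda>n. ereal (v n))"
    and "limsup (\<lambda>n. ereal (u n)) = limsup (\<lambda>n. ereal (v n))"
proof -
  have *: "(\<lambda>n. ereal (u n - v n)) \<longlonglongrightarrow> 0"
    using tendsto_ereal[OF assms] by (simp add: zero_ereal_def)
  show "liminf (\<lambda>n. ereal (u n)) = liminf (\<lambda>n. ereal (v n))"
    using ereal_liminf_lim_add[OF *, of "\<lambda>n. ereal (v n)"] by simp
  show "limsup (\<lambda>n. ereal (u n)) = limsup (\<lambda>n. ereal (v n))"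
    using ereal_limsup_lim_add[OF *, of "\<lambda>n. ereal (v n)"] by simp
qed

text \<open>Isolates the vector of betting proportions, whose convergence is the assumption of the
  weighted case. With denominator 0 both sides are 0.\<close>

lemma cum_ratio_const_eq:
  "cum_ratio B (\<lambda>_ _. \<mu>) n \<omega> = ((\<Sum>k=1..n. B k \<omega>) /\<^sub>R (\<Sum>k=1..n. B k \<omega> \<bullet> 1)) \<bullet> \<mu>"
  by (simp add: cum_ratio_def inner_sum_left divide_inverse mult.commute)

text \<open>The ratio is a convex combination of the entries of \<open>\<mu>\<close>, weighted by
  the cumulative bets. Free bounds \<open>l\<close> and \<open>u\<close> cover both the extreme
  entries and the case of equal entries.\<close>

lemma cum_ratio_const_bounds:
  fixes \<mu> :: "real ^ 'd"
  assumes nonneg: "\<And>k i. k \<ge> 1 \<Longrightarrow> 0 \<le> B k \<omega> $ i"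
    and pos: "0 < (\<Sum>k=1..n. B k \<omega> \<bullet> 1)"
    and bounds: "\<And>i. l \<le> \<mu> $ i" "\<And>i. \<mu> $ i \<le> u"
  shows "l \<le> cum_ratio B (\<lambda>_ _. \<mu>) n \<omega>" and "cum_ratio B (\<lambda>_ _. \<mu>) n \<omega> \<le> u"
proof -
  have "l * (B k \<omega> \<bullet> 1) \<le> B k \<omega> \<bullet> \<mu>" "B k \<omega> \<bullet> \<mu> \<le> u * (B k \<omega> \<bullet> 1)" if "k \<ge> 1" for k
    using nonneg[OF that] bounds unfolding inner_vec_def sum_distrib_left
    by (auto intro!: sum_mono simp: mult.commute intro: mult_left_mono mult_right_mono)
  then have "l * (\<Sum>k=1..n. B k \<omega> \<bullet> 1) \<le> (\<Sum>k=1..n. B k \<omega> \<bullet> \<mu>)"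
    "(\<Sum>k=1..n. B k \<omega> \<bullet> \<mu>) \<le> u * (\<Sum>k=1..n. B k \<omega> \<bullet> 1)"
    unfolding sum_distrib_left by (auto intro!: sum_mono)
  then show "l \<le> cum_ratio B (\<lambda>_ _. \<mu>) n \<omega>" and "cum_ratio B (\<lambda>_ _. \<mu>) n \<omega> \<le> u"
    using pos by (simp_all add: cum_ratio_def field_simps)
qed

text \<open>Any \<open>c\<close> strictly between 0 and the limit inferior works;
  \<open>n \<ge> 1\<close> is recorded so that the division by \<open>n\<close> can be
  cleared.\<close>

lemma eventually_linear_growth:
  assumes "liminf (\<lambda>n. ereal (1 / real n * s n)) > 0"
  obtains c where "c > 0" "eventually (\<lambda>n. n \<ge> 1 \<and> c * real n < s n) sequentially"
proof -
  obtain c where c: "0 < c" "ereal c < liminf (\<lambda>n. ereal (1 / real n * s n))"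
    using ereal_dense2[OF assms] by auto
  have "eventually (\<lambda>n. n \<ge> 1 \<and> c * real n < s n) sequentially"
    using less_LiminfD[OF c(2)] eventually_ge_at_top[of 1]
    by eventually_elim (auto simp: field_simps)
  with c(1) show ?thesis by (rule that)
qed

text \<open>Over the common denominator the difference is the centred sum divided by the total bet.
  Since the latter eventually exceeds \<open>c * n\<close>, the difference is at most the absolute
  centred average divided by \<open>c\<close>.\<close>

lemma cum_ratio_diff_tendsto_0:
  fixes \<mu> :: "real ^ 'd"
  assumes growth: "liminf (\<lambda>n. ereal (1 / real n * (\<Sum>k=1..n. B k \<omega> \<bullet> 1))) > 0"
    and lim: "(\<lambda>n. (\<Sum>k=1..n. B k \<omega> \<bullet> (Y k \<omega> - \<mu>)) / n) \<longlonglongrightarrow> 0"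
  shows "(\<lambda>n. cum_ratio B Y n \<omega> - cum_ratio B (\<lambda>_ _. \<mu>) n \<omega>) \<longlonglongrightarrow> 0"
proof -
  obtain c where c: "c > 0"
    and ev: "eventually (\<lambda>n. n \<ge> 1 \<and> c * real n < (\<Sum>k=1..n. B k \<omega> \<bullet> 1)) sequentially"
    using eventually_linear_growth[OF growth] .
  have lim': "(\<lambda>n. \<bar>(\<Sum>k=1..n. B k \<omega> \<bullet> (Y k \<omega> - \<mu>)) / n\<bar> / c) \<longlonglongrightarrow> 0"
    using tendsto_divide_zero[OF tendsto_rabs_zero[OF lim]] by simp
  show ?thesis
  proof (rule Lim_null_comparison[OF _ lim'])
    show "\<forall>\<^sub>F n in sequentially. norm (cum_ratio B Y n \<omega> - cum_ratio B (\<lambda>_ _. \<mu>) n \<omega>)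
        \<le> \<bar>(\<Sum>k=1..n. B k \<omega> \<bullet> (Y k \<omega> - \<mu>)) / n\<bar> / c"
      using ev
    proof eventually_elim
      case (elim n)
      have "0 < c * n" using c elim by simp
      have "cum_ratio B Y n \<omega> - cum_ratio B (\<lambda>_ _. \<mu>) n \<omega>
          = (\<Sum>k=1..n. B k \<omega> \<bullet> (Y k \<omega> - \<mu>)) / (\<Sum>k=1..n. B k \<omega> \<bullet> 1)"
        by (simp add: cum_ratio_def inner_diff_right sum_subtractf diff_divide_distrib)
      also have "norm \<dots> \<le> \<bar>\<Sum>k=1..n. B k \<omega> \<bullet> (Y k \<omega> - \<mu>)\<bar> / (c * n)"
        unfolding real_norm_def abs_divide using elim \<open>0 < c * n\<close>
        by (intro divide_left_mono) auto
      finally show ?case by (simp add: abs_divide mult.commute)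
    qed
  qed
qed


section \<open>Almost sure asymptotics for one sequence of outcomes per unit bet\<close>

text \<open>Keeps \<open>Y\<close> abstract and of arbitrary sign, so that returns and profits are
  two instances of one argument.\<close>

locale predictable_bets = prob_space M for M :: "'a measure" +
  fixes F :: "nat \<Rightarrow> 'a measure" and B Y :: "nat \<Rightarrow> 'a \<Rightarrow> real ^ 'd"
  assumes filt: "filtration (space M) F" and sub: "\<And>n. subalgebra M (F n)"
    and B_nonneg: "\<And>n \<omega> i. n \<ge> 1 \<Longrightarrow> \<omega> \<in> space M \<Longrightarrow> 0 \<le> B n \<omega> $ i"
    and B: "\<And>n. n \<ge> 1 \<Longrightarrow> B n \<in> borel_measurable (F (n - 1))"
    and B_moment: "(SUP n\<in>{1..}. \<integral>\<^sup>+ \<omega>. ennreal ((norm (B n \<omega>))\<^sup>2) \<partial>M) < \<infinity>"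
    and B_liminf: "AE \<omega> in M. liminf (\<lambda>n. ereal (1 / real n * (\<Sum>k=1..n. B k \<omega> \<bullet> 1))) > 0"
    and Y: "\<And>n. n \<ge> 1 \<Longrightarrow> Y n \<in> borel_measurable (F n)"
    and indep: "\<And>n. n \<ge> 1 \<Longrightarrow> indep_of_subalgebra M (F (n - 1)) (Y n)"
    and distr: "\<And>n. n \<ge> 1 \<Longrightarrow> distr M borel (Y n) = distr M borel (Y 1)"
    and Y_moment: "(\<integral>\<^sup>+ \<omega>. ennreal ((norm (Y 1 \<omega>))\<^sup>2) \<partial>M) < \<infinity>"
begin

definition \<mu> :: "real ^ 'd" where
  "\<mu> = vec_expectation M (Y 1)"

text \<open>The dot product splits into coordinates. For each \<open>i\<close> the scalar law
  applies with bets \<open>B n \<omega> $ i\<close> and \<open>g y = y $ i - \<mu> $ i\<close>, and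
  finitely many null sets are discarded together.\<close>

lemma bet_average_tendsto_0:
  "AE \<omega> in M. (\<lambda>n. (\<Sum>k=1..n. B k \<omega> \<bullet> (Y k \<omega> - \<mu>)) / n) \<longlonglongrightarrow> 0"
proof -
  \<comment> \<open>The finite supremum supplies a single real constant bounding the second moments
    for all coups.\<close>
  obtain C where C: "(SUP n\<in>{1..}. \<integral>\<^sup>+ \<omega>. ennreal ((norm (B n \<omega>))\<^sup>2) \<partial>M) = ennreal C" "0 \<le> C"
    using B_moment unfolding infinity_ennreal_def less_top_ennreal by blast
  have B_le: "(\<integral>\<^sup>+ \<omega>. ennreal ((norm (B n \<omega>))\<^sup>2) \<partial>M) \<le> ennreal C" if "n \<ge> 1" for n
    unfolding C(1)[symmetric] using that by (intro SUP_upper) auto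
  have B_meas: "B n \<in> borel_measurable M" if "n \<ge> 1" for n
    using measurable_from_subalg[OF sub B[OF that]] .
  obtain D where D: "(\<integral>\<^sup>+ \<omega>. ennreal ((norm (Y 1 \<omega>))\<^sup>2) \<partial>M) = ennreal D" "0 \<le> D"
    using Y_moment unfolding infinity_ennreal_def less_top_ennreal by blast
  have Y_meas[measurable]: "Y 1 \<in> borel_measurable M"
    using measurable_from_subalg[OF sub Y[of 1]] by simp
  have Y_sq: "integrable M (\<lambda>\<omega>. (Y 1 \<omega> $ i)\<^sup>2)" for i
    using component_second_moment[OF Y_meas _ D(2)] D(1) by simp
  have Y_int: "integrable M (\<lambda>\<omega>. Y 1 \<omega> $ i)" for i
    by (rule square_integrable_vec[OF Y_meas Y_moment])
  have "AE \<omega> in M. (\<lambda>n. (\<Sum>k=1..n. B k \<omega> $ i * (Y k \<omega> $ i - \<mu> $ i)) / n) \<longlonglongrightarrow> 0" for i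
  proof (rule predictable_transform_average_tendsto_0[OF filt sub _ _ _ Y indep distr])
    fix n :: nat assume n: "n \<ge> 1"
    show "(\<lambda>\<omega>. B n \<omega> $ i) \<in> borel_measurable (F (n - 1))"
      using B[OF n] by measurable
    show "integrable M (\<lambda>\<omega>. (B n \<omega> $ i)\<^sup>2)" "expectation (\<lambda>\<omega>. (B n \<omega> $ i)\<^sup>2) \<le> C"
      using component_second_moment[OF B_meas B_le C(2)] n by auto
  next
    show "integrable M (\<lambda>\<omega>. (Y 1 \<omega> $ i - \<mu> $ i)\<^sup>2)"
      unfolding power2_diff using Y_sq[of i] Y_int[of i] by auto
    show "expectation (\<lambda>\<omega>. Y 1 \<omega> $ i - \<mu> $ i) = 0"
      using Y_int[of i] by (simp add: \<mu>_def vec_expectation_def prob_space)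
  qed auto
  then have "AE \<omega> in M. \<forall>i\<in>UNIV. (\<lambda>n. (\<Sum>k=1..n. B k \<omega> $ i * (Y k \<omega> $ i - \<mu> $ i)) / n) \<longlonglongrightarrow> 0"
    by (intro AE_finite_allI) auto
  then show ?thesis
  proof eventually_elim
    case (elim \<omega>)
    then have "(\<lambda>n. \<Sum>i\<in>UNIV. (\<Sum>k=1..n. B k \<omega> $ i * (Y k \<omega> $ i - \<mu> $ i)) / n) \<longlonglongrightarrow> 0"
      by (intro tendsto_null_sum) auto
    moreover have "(\<Sum>i\<in>UNIV. (\<Sum>k=1..n. B k \<omega> $ i * (Y k \<omega> $ i - \<mu> $ i)) / n)
        = (\<Sum>k=1..n. B k \<omega> \<bullet> (Y k \<omega> - \<mu>)) / n" for n
      unfolding inner_vec_def by (subst sum.swap) (simp add: sum_divide_distrib)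
    ultimately show ?case by simp
  qed
qed

lemma AE_cum_ratio_diff_tendsto_0:
  "AE \<omega> in M. (\<lambda>n. cum_ratio B Y n \<omega> - cum_ratio B (\<lambda>_ _. \<mu>) n \<omega>) \<longlonglongrightarrow> 0"
  using B_liminf bet_average_tendsto_0
  by eventually_elim (rule cum_ratio_diff_tendsto_0)

text \<open>From some index on, the default value 0 of \<open>cum_ratio\<close> at a vanishing
  denominator does not occur.\<close>

lemma AE_eventually_sum_bets_pos:
  "AE \<omega> in M. \<forall>\<^sub>F n in sequentially. 0 < (\<Sum>k=1..n. B k \<omega> \<bullet> 1)"
  using B_liminf
proof eventually_elim
  case (elim \<omega>)
  then obtain c where "c > 0"
    and ev: "\<forall>\<^sub>F n in sequentially. n \<ge> 1 \<and> c * real n < (\<Sum>k=1..n. B k \<omega> \<bullet> 1)"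
    using eventually_linear_growth[of "\<lambda>n. \<Sum>k=1..n. B k \<omega> \<bullet> 1"] by blast
  show ?case
    using ev by eventually_elim (meson \<open>c > 0\<close> less_imp_le less_le_trans mult_nonneg_nonneg of_nat_0_le_iff le_less_trans)
qed

lemma AE_eventually_cum_ratio_mean_bounds:
  assumes "\<And>i. l \<le> \<mu> $ i" and "\<And>i. \<mu> $ i \<le> u"
  shows "AE \<omega> in M. \<forall>\<^sub>F n in sequentially.
      l \<le> cum_ratio B (\<lambda>_ _. \<mu>) n \<omega> \<and> cum_ratio B (\<lambda>_ _. \<mu>) n \<omega> \<le> u"
  \<comment> \<open>\<open>AE_space\<close> enters because bets are assumed nonnegative only at
    points of the sample space.\<close>
  using AE_eventually_sum_bets_pos AE_space
proof eventually_elim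
  case (elim \<omega>)
  show ?case
    using elim(1)
    by eventually_elim (use cum_ratio_const_bounds[of B \<omega>] B_nonneg elim(2) assms in blast)
qed

lemma cum_ratio_liminf_limsup:
  assumes "\<And>i. l \<le> \<mu> $ i" and "\<And>i. \<mu> $ i \<le> u"
  shows "AE \<omega> in M.
        ereal l \<le> liminf (\<lambda>n. ereal (cum_ratio B (\<lambda>_ _. \<mu>) n \<omega>)) \<and>
        liminf (\<lambda>n. ereal (cum_ratio B (\<lambda>_ _. \<mu>) n \<omega>)) = liminf (\<lambda>n. ereal (cum_ratio B Y n \<omega>)) \<and>
        liminf (\<lambda>n. ereal (cum_ratio B Y n \<omega>)) \<le> limsup (\<lambda>n. ereal (cum_ratio B Y n \<omega>)) \<and>
        limsup (\<lambda>n. ereal (cum_ratio B Y n \<omega>)) = limsup (\<lambda>n. ereal (cum_ratio B (\<lambda>_ _. \<mu>) n \<omega>)) \<and>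
        limsup (\<lambda>n. ereal (cum_ratio B (\<lambda>_ _. \<mu>) n \<omega>)) \<le> ereal u"
  using AE_cum_ratio_diff_tendsto_0 AE_eventually_cum_ratio_mean_bounds[OF assms]
proof eventually_elim
  case (elim \<omega>)
  have "ereal l \<le> liminf (\<lambda>n. ereal (cum_ratio B (\<lambda>_ _. \<mu>) n \<omega>))"
    by (rule Liminf_bounded) (use elim(2) in \<open>auto elim: eventually_mono\<close>)
  moreover have "limsup (\<lambda>n. ereal (cum_ratio B (\<lambda>_ _. \<mu>) n \<omega>)) \<le> ereal u"
    by (rule Limsup_bounded) (use elim(2) in \<open>auto elim: eventually_mono\<close>)
  moreover have "liminf (\<lambda>n. ereal (cum_ratio B Y n \<omega>)) \<le> limsup (\<lambda>n. ereal (cum_ratio B Y n \<omega>))"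
    by (rule Liminf_le_Limsup) simp
  ultimately show ?case
    using liminf_limsup_eq_if_diff_tendsto_0[OF elim(1)] by simp
qed

text \<open>Here the lower and upper bounds coincide, so the ratio for the mean is eventually the
  constant \<open>c\<close>.\<close>

lemma cum_ratio_tendsto_if_equal_means:
  assumes "\<And>i. \<mu> $ i = c"
  shows "AE \<omega> in M. (\<lambda>n. cum_ratio B Y n \<omega>) \<longlonglongrightarrow> c"
proof -
  have "AE \<omega> in M. \<forall>\<^sub>F n in sequentially. c \<le> cum_ratio B (\<lambda>_ _. \<mu>) n \<omega> \<and> cum_ratio B (\<lambda>_ _. \<mu>) n \<omega> \<le> c"
    by (rule AE_eventually_cum_ratio_mean_bounds) (simp_all add: assms)
  with AE_cum_ratio_diff_tendsto_0 show ?thesis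
  proof eventually_elim
    case (elim \<omega>)
    have "(\<lambda>n. cum_ratio B (\<lambda>_ _. \<mu>) n \<omega>) \<longlonglongrightarrow> c"
      by (rule tendsto_eventually) (use elim(2) in \<open>auto elim: eventually_mono\<close>)
    from tendsto_add[OF elim(1) this] show ?case by simp
  qed
qed

text \<open>The ratio for the mean is the inner product of the betting proportions with
  \<open>\<mu>\<close>, so continuity gives its limit.\<close>

lemma cum_ratio_tendsto_if_weights:
  assumes "AE \<omega> in M. (\<lambda>n. (\<Sum>k=1..n. B k \<omega>) /\<^sub>R (\<Sum>k=1..n. B k \<omega> \<bullet> 1)) \<longlonglongrightarrow> w"
  shows "AE \<omega> in M. (\<lambda>n. cum_ratio B Y n \<omega>) \<longlonglongrightarrow> (\<Sum>i\<in>UNIV. w $ i * \<mu> $ i)"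
  using AE_cum_ratio_diff_tendsto_0 assms
proof eventually_elim
  case (elim \<omega>)
  have "(\<lambda>n. cum_ratio B (\<lambda>_ _. \<mu>) n \<omega>) \<longlonglongrightarrow> w \<bullet> \<mu>"
    unfolding cum_ratio_const_eq by (intro tendsto_inner elim(2) tendsto_const)
  from tendsto_add[OF elim(1) this] show ?case by (simp add: inner_vec_def)
qed

end

section \<open>Passing between returns and profits, and the combined result\<close>

text \<open>Rests on \<open>(a + b)^2 \<le> 2 * a^2 + 2 * b^2\<close> and the finiteness of
  constants' integrals. Used with \<open>c = - 1\<close> and \<open>c = 1\<close>, it gives both
  directions of the moment equivalence.\<close>

lemma (in prob_space) second_moment_finite_shift:
  fixes Y Z :: "'a \<Rightarrow> real ^ 'd"
  assumes [measurable]: "Y \<in> borel_measurable M"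
    and shift: "\<And>\<omega>. \<omega> \<in> space M \<Longrightarrow> Z \<omega> = Y \<omega> + c"
    and fin: "(\<integral>\<^sup>+ \<omega>. ennreal ((norm (Y \<omega>))\<^sup>2) \<partial>M) < \<infinity>"
  shows "(\<integral>\<^sup>+ \<omega>. ennreal ((norm (Z \<omega>))\<^sup>2) \<partial>M) < \<infinity>"
proof -
  have le: "(norm (y + c))\<^sup>2 \<le> 2 * (norm y)\<^sup>2 + 2 * (norm c)\<^sup>2" for y
  proof -
    have "(norm (y + c))\<^sup>2 \<le> (norm y + norm c)\<^sup>2"
      by (intro power_mono norm_triangle_ineq) simp
    also have "\<dots> \<le> 2 * (norm y)\<^sup>2 + 2 * (norm c)\<^sup>2"
      using sum_squares_bound[of "norm y" "norm c"] by (simp add: power2_sum)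
    finally show ?thesis .
  qed
  have "(\<integral>\<^sup>+ \<omega>. ennreal ((norm (Z \<omega>))\<^sup>2) \<partial>M)
      \<le> (\<integral>\<^sup>+ \<omega>. 2 * ennreal ((norm (Y \<omega>))\<^sup>2) + ennreal (2 * (norm c)\<^sup>2) \<partial>M)"
  proof (intro nn_integral_mono)
    fix \<omega> assume "\<omega> \<in> space M"
    then have "ennreal ((norm (Z \<omega>))\<^sup>2) \<le> ennreal (2 * (norm (Y \<omega>))\<^sup>2 + 2 * (norm c)\<^sup>2)"
      using shift le[of "Y \<omega>"] by (intro ennreal_leI) simp
    then show "ennreal ((norm (Z \<omega>))\<^sup>2) \<le> 2 * ennreal ((norm (Y \<omega>))\<^sup>2) + ennreal (2 * (norm c)\<^sup>2)"
      by (simp add: ennreal_plus ennreal_mult')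
  qed
  also have "\<dots> = 2 * (\<integral>\<^sup>+ \<omega>. ennreal ((norm (Y \<omega>))\<^sup>2) \<partial>M) + ennreal (2 * (norm c)\<^sup>2)"
    by (simp add: nn_integral_add nn_integral_cmult emeasure_space_1)
  also have "\<dots> < \<infinity>"
    using fin by (simp add: ennreal_mult_less_top)
  finally show ?thesis .
qed

theorem corollary5p1:
  fixes M :: "'a measure"
    and F :: "nat \<Rightarrow> 'a measure"
    and B R X :: "nat \<Rightarrow> 'a \<Rightarrow> real ^ 'd"
  assumes "prob_space M"
    and "filtration (space M) F"
    and "\<And>n. subalgebra M (F n)"
    and B_nonneg: "\<And>n \<omega> i. n \<ge> 1 \<Longrightarrow> \<omega> \<in> space M \<Longrightarrow> 0 \<le> B n \<omega> $ i"
    and B_predictable: "\<And>n. n \<ge> 1 \<Longrightarrow> B n \<in> borel_measurable (F (n - 1))"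
    and R_nonneg: "\<And>n \<omega> i. n \<ge> 1 \<Longrightarrow> \<omega> \<in> space M \<Longrightarrow> 0 \<le> R n \<omega> $ i"
    and X_eq: "\<And>n \<omega> i. n \<ge> 1 \<Longrightarrow> \<omega> \<in> space M \<Longrightarrow> X n \<omega> $ i = R n \<omega> $ i - 1"
    and "iid_seq M R"
    and "iid_seq M X"
    and R_adapted: "\<And>n. n \<ge> 1 \<Longrightarrow> R n \<in> borel_measurable (F n)"
    and X_adapted: "\<And>n. n \<ge> 1 \<Longrightarrow> X n \<in> borel_measurable (F n)"
    and R_indep: "\<And>n. n \<ge> 1 \<Longrightarrow> indep_of_subalgebra M (F (n - 1)) (R n)"
    and X_indep: "\<And>n. n \<ge> 1 \<Longrightarrow> indep_of_subalgebra M (F (n - 1)) (X n)"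
    and B_moment: "(SUP n\<in>{1..}. \<integral>\<^sup>+ \<omega>. ennreal ((norm (B n \<omega>))\<^sup>2) \<partial>M) < \<infinity>"
    and B_liminf: "AE \<omega> in M.
      liminf (\<lambda>n. ereal (1 / real n * (\<Sum>k=1..n. B k \<omega> \<bullet> 1))) > 0"
  shows
    "((\<integral>\<^sup>+ \<omega>. ennreal ((norm (R 1 \<omega>))\<^sup>2) \<partial>M) < \<infinity> \<longleftrightarrow>
      (\<integral>\<^sup>+ \<omega>. ennreal ((norm (X 1 \<omega>))\<^sup>2) \<partial>M) < \<infinity>) \<and>
     ((\<integral>\<^sup>+ \<omega>. ennreal ((norm (R 1 \<omega>))\<^sup>2) \<partial>M) < \<infinity> \<longrightarrow>
      (let rtp = (\<lambda>i. RTP M (\<lambda>_. 1) (\<lambda>\<omega>. R 1 \<omega> $ i));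
           ha = (\<lambda>i. HA M (\<lambda>_. 1) (\<lambda>\<omega>. X 1 \<omega> $ i));
           muR = vec_expectation M (R 1);
           muX = vec_expectation M (X 1)
       in
        (AE \<omega> in M.
           ereal (MIN i. rtp i) \<le> liminf (\<lambda>n. ereal (cum_ratio B (\<lambda>_ _. muR) n \<omega>)) \<and>
           liminf (\<lambda>n. ereal (cum_ratio B (\<lambda>_ _. muR) n \<omega>)) = liminf (\<lambda>n. ereal (cum_ratio B R n \<omega>)) \<and>
           liminf (\<lambda>n. ereal (cum_ratio B R n \<omega>)) \<le> limsup (\<lambda>n. ereal (cum_ratio B R n \<omega>)) \<and>
           limsup (\<lambda>n. ereal (cum_ratio B R n \<omega>)) = limsup (\<lambda>n. ereal (cum_ratio B (\<lambda>_ _. muR) n \<omega>)) \<and>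
           limsup (\<lambda>n. ereal (cum_ratio B (\<lambda>_ _. muR) n \<omega>)) \<le> ereal (MAX i. rtp i)) \<and>
        (AE \<omega> in M.
           ereal (- (MAX i. ha i)) \<le> liminf (\<lambda>n. ereal (cum_ratio B (\<lambda>_ _. muX) n \<omega>)) \<and>
           liminf (\<lambda>n. ereal (cum_ratio B (\<lambda>_ _. muX) n \<omega>)) = liminf (\<lambda>n. ereal (cum_ratio B X n \<omega>)) \<and>
           liminf (\<lambda>n. ereal (cum_ratio B X n \<omega>)) \<le> limsup (\<lambda>n. ereal (cum_ratio B X n \<omega>)) \<and>
           limsup (\<lambda>n. ereal (cum_ratio B X n \<omega>)) = limsup (\<lambda>n. ereal (cum_ratio B (\<lambda>_ _. muX) n \<omega>)) \<and>
           limsup (\<lambda>n. ereal (cum_ratio B (\<lambda>_ _. muX) n \<omega>)) \<le> ereal (- (MIN i. ha i))) \<and>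
        (\<forall>i0. ((\<forall>i. rtp i = rtp i0) \<longleftrightarrow> (\<forall>i. ha i = ha i0)) \<and>
              ((\<forall>i. rtp i = rtp i0) \<longrightarrow>
                 (AE \<omega> in M. (\<lambda>n. cum_ratio B R n \<omega>) \<longlonglongrightarrow> rtp i0) \<and>
                 (AE \<omega> in M. (\<lambda>n. cum_ratio B X n \<omega>) \<longlonglongrightarrow> - ha i0))) \<and>
        (\<forall>w :: real ^ 'd.
           (AE \<omega> in M. (\<lambda>n. (\<Sum>k=1..n. B k \<omega>) /\<^sub>R (\<Sum>k=1..n. B k \<omega> \<bullet> 1)) \<longlonglongrightarrow> w) \<longrightarrow>
             (AE \<omega> in M. (\<lambda>n. cum_ratio B R n \<omega>) \<longlonglongrightarrow> (\<Sum>i\<in>UNIV. w $ i * rtp i)) \<and>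
             (AE \<omega> in M. (\<lambda>n. cum_ratio B X n \<omega>) \<longlonglongrightarrow> - (\<Sum>i\<in>UNIV. w $ i * ha i)))))"
proof -
  interpret prob_space M by fact
  have R_meas: "R n \<in> borel_measurable M" and X_meas: "X n \<in> borel_measurable M" if "n \<ge> 1" for n
    using measurable_from_subalg[OF assms(3)] R_adapted X_adapted that by blast+
  have R_distr: "distr M borel (R n) = distr M borel (R 1)" and X_distr: "distr M borel (X n) = distr M borel (X 1)"
    if "n \<ge> 1" for n
    using \<open>iid_seq M R\<close> \<open>iid_seq M X\<close> that unfolding iid_seq_def by blast+
  have X_R: "X 1 \<omega> = R 1 \<omega> + (- 1)" "R 1 \<omega> = X 1 \<omega> + 1" if "\<omega> \<in> space M" for \<omega>
    using X_eq[of 1 \<omega>] that by (simp_all add: vec_eq_iff)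
  have equiv: "(\<integral>\<^sup>+ \<omega>. ennreal ((norm (R 1 \<omega>))\<^sup>2) \<partial>M) < \<infinity> \<longleftrightarrow>
      (\<integral>\<^sup>+ \<omega>. ennreal ((norm (X 1 \<omega>))\<^sup>2) \<partial>M) < \<infinity>"
    using second_moment_finite_shift[OF R_meas X_R(1)] second_moment_finite_shift[OF X_meas X_R(2)]
    by blast
  show ?thesis
  proof (intro conjI impI equiv, goal_cases)
    case R_moment: 1
    with equiv have X_moment: "(\<integral>\<^sup>+ \<omega>. ennreal ((norm (X 1 \<omega>))\<^sup>2) \<partial>M) < \<infinity>"
      by blast
    interpret R: predictable_bets M F B R
      by (intro predictable_bets.intro predictable_bets_axioms.intro)
        (fact assms(1-3) B_nonneg B_predictable B_moment B_liminf R_adapted R_indep R_distr R_moment)+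
    interpret X: predictable_bets M F B X
      by (intro predictable_bets.intro predictable_bets_axioms.intro)
        (fact assms(1-3) B_nonneg B_predictable B_moment B_liminf X_adapted X_indep X_distr X_moment)+
    define rtp where "rtp = (\<lambda>i. RTP M (\<lambda>_. 1) (\<lambda>\<omega>. R 1 \<omega> $ i))"
    define ha where "ha = (\<lambda>i. HA M (\<lambda>_. 1) (\<lambda>\<omega>. X 1 \<omega> $ i))"
    \<comment> \<open>With unit bets, \<open>RTP\<close> is the mean return and \<open>HA\<close>
      the negated mean profit. The sign exchanges \<open>MAX\<close> and \<open>MIN\<close> of
      \<open>ha\<close> in the bounds for profits.\<close>
    have rtp: "R.\<mu> $ i = rtp i" and ha: "X.\<mu> $ i = - ha i" for i
      by (simp_all add: rtp_def ha_def R.\<mu>_def X.\<mu>_def RTP_def HA_def vec_expectation_def prob_space)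
    \<comment> \<open>This affine relation makes equality of all \<open>rtp i\<close> equivalent to
      equality of all \<open>ha i\<close>.\<close>
    have ha_rtp: "ha i = 1 - rtp i" for i
    proof -
      have "X.\<mu> $ i = expectation (\<lambda>\<omega>. R 1 \<omega> $ i - 1)"
        unfolding X.\<mu>_def vec_expectation_def
        by (simp, intro Bochner_Integration.integral_cong refl, use X_eq[of 1] in simp)
      also have "\<dots> = R.\<mu> $ i - 1"
        using square_integrable_vec[OF R_meas R_moment, of i]
        by (simp add: R.\<mu>_def vec_expectation_def prob_space)
      finally show ?thesis by (simp add: ha rtp)
    qed
    have equal: "\<forall>i0. ((\<forall>i. rtp i = rtp i0) \<longleftrightarrow> (\<forall>i. ha i = ha i0)) \<and>
        ((\<forall>i. rtp i = rtp i0) \<longrightarrow>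
          (AE \<omega> in M. (\<lambda>n. cum_ratio B R n \<omega>) \<longlonglongrightarrow> rtp i0) \<and>
          (AE \<omega> in M. (\<lambda>n. cum_ratio B X n \<omega>) \<longlonglongrightarrow> - ha i0))"
      by (intro allI conjI impI R.cum_ratio_tendsto_if_equal_means X.cum_ratio_tendsto_if_equal_means)
        (auto simp: rtp ha ha_rtp)
    have weighted: "\<forall>w.
        (AE \<omega> in M. (\<lambda>n. (\<Sum>k=1..n. B k \<omega>) /\<^sub>R (\<Sum>k=1..n. B k \<omega> \<bullet> 1)) \<longlonglongrightarrow> w) \<longrightarrow>
          (AE \<omega> in M. (\<lambda>n. cum_ratio B R n \<omega>) \<longlonglongrightarrow> (\<Sum>i\<in>UNIV. w $ i * rtp i)) \<and>
          (AE \<omega> in M. (\<lambda>n. cum_ratio B X n \<omega>) \<longlonglongrightarrow> - (\<Sum>i\<in>UNIV. w $ i * ha i))"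
      using R.cum_ratio_tendsto_if_weights X.cum_ratio_tendsto_if_weights
      by (simp add: rtp ha sum_negf)
    \<comment> \<open>What remains after the general results is that the entries of the two means
      lie between the stated extremes, taken over a finite index type.\<close>
    show ?case
      unfolding Let_def rtp_def[symmetric] ha_def[symmetric] R.\<mu>_def[symmetric] X.\<mu>_def[symmetric]
      by (intro conjI equal weighted R.cum_ratio_liminf_limsup X.cum_ratio_liminf_limsup)
        (simp_all add: rtp ha)
  qed
qed

end
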